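(* Sequential circuits, i.e. increasing causal functions $\mathbb{S}_{{A_1}_\bot}\times\dots\times\mathbb{S}_{{A_n}_\bot}\to\mathbb{S}_{{A_{n+1}}_\bot}\times\dots\times\mathbb{S}_{{A_p}_\bot}$ (with each $A_i$ a base type, that is, a set), where feedback wires are interpreted by least fixed points internal to the topos of causal sets, obey the laws of traced categories.
   Context: A causal set is an object of the topos of presheaves over $\mathbb{N}$ with its standard ordering: a family $(A_n)_{n\in\mathbb{N}}$ of sets (the prefixes) with restriction functions $r_n : A_{n+1}\to A_n$. A causal function $f : A\to B$ is a family of functions $f_n : A_n\to B_n$ with $r_n(f_{n+1}(a))=f_n(r_n(a))$. A bounded height domain is a partially ordered set $D$ equipped with a number $b$ such that every increasing chain $x_1\leqslant\dots\leqslant x_n$ in $D$ with $n>b$ has a pair $x_i\geqslant x_j$ with $i<j$. A bounded height domain with a smallest element internal to the topos of causal sets is, externally, a causal set $A$ with, for each $n$, a partial order on $A_n$ making it a bounded height domain with a smallest element (the bound may depend on $n$), such that the restriction functions are increasing (order preserving) and map smallest elements to smallest elements. A causal function $f$ between such objects is increasing if each $f_n$ is increasing. For a set $A$, $A_\bot$ is the poset obtained by adding to $A$ (ordered by equality) a new element $\bot$ strictly below every element of $A$. $\mathbb{S}_{A_\bot}$ is the causal set with $(\mathbb{S}_{A_\bot})_n=A_\bot^n$, ordered componentwise, and $r_n(w\cdot a)=w$ (dropping the last entry); it is an internal bounded height domain with a smallest element, and so are finite products of such causal sets (taken prefixwise, with the componentwise order). Feedback: for $f : A\times X\to X$ an increasing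 causal function between internal bounded height domains with a smallest element, $\mu(f) : A\to X$ denotes the increasing causal function given by the internal local least fixed point, i.e. internally $\mu(f)(a)$ is the least fixed point of $x\mapsto f(a,x)$ (an internal fixed point is one that is a fixed point at each prefix). Feedback along $X$ of a circuit $f : A\times X\to B\times X$ is the trace obtained from $\mu$ by Hasegawa's construction of a trace from a fixed-point operator in a cartesian category, namely $\pi_B\circ f\circ\langle \mathrm{id}_A,\mu(\pi_X\circ f)\rangle : A\to B$. The laws of traced categories are the equations of traced monoidal categories of Joyal, Street and Verity, the monoidal structure here being the cartesian product. *)

theory Defs
  imports Main "HOL-Library.FuncSet"
begin

section \<open>Ordered causal sets and bounded height domains\<close>

record 'x causal_poset =
  prefixes :: "nat \<Rightarrow> 'x set"
  restr :: "nat \<Rightarrow> 'x \<Rightarrow> 'x"  \<comment> \<open>\<open>restr D n\<close> goes from stage \<open>Suc n\<close> to stage \<open>n\<close>\<close>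
  porder :: "nat \<Rightarrow> 'x rel"

definition is_least :: "'x set \<Rightarrow> 'x rel \<Rightarrow> 'x \<Rightarrow> bool" where
  "is_least S r x \<longleftrightarrow> x \<in> S \<and> (\<forall>y\<in>S. (x, y) \<in> r)"

definition bounded_height :: "'x set \<Rightarrow> 'x rel \<Rightarrow> bool" where
  "bounded_height S r \<longleftrightarrow>
     (\<exists>b. \<forall>xs. set xs \<subseteq> S \<longrightarrow> successively (\<lambda>x y. (x, y) \<in> r) xs \<longrightarrow> b < length xs \<longrightarrow>
        (\<exists>i j. i < j \<and> j < length xs \<and> (xs ! j, xs ! i) \<in> r))"

definition internal_bhd :: "'x causal_poset \<Rightarrow> bool" where
  "internal_bhd D \<longleftrightarrow>
     (\<forall>n. partial_order_on (prefixes D n) (porder D n)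
        \<and> bounded_height (prefixes D n) (porder D n)
        \<and> (\<exists>x. is_least (prefixes D n) (porder D n) x)
        \<and> restr D n \<in> prefixes D (Suc n) \<rightarrow> prefixes D n
        \<and> (\<forall>x y. (x, y) \<in> porder D (Suc n) \<longrightarrow> (restr D n x, restr D n y) \<in> porder D n)
        \<and> (\<forall>x. is_least (prefixes D (Suc n)) (porder D (Suc n)) x
               \<longrightarrow> is_least (prefixes D n) (porder D n) (restr D n x)))"

text \<open>
  Functions are taken extensionally (constant \<open>undefined\<close> outside the stage),
  so that equality of causal functions is equality in HOL.
\<close>

definition increasing_causal :: "'x causal_poset \<Rightarrow> 'y causal_poset \<Rightarrow> (nat \<Rightarrow> 'x \<Rightarrow> 'y) set" where
  "increasing_causal D E =
     {f. \<forall>n. f n \<in> prefixes D n \<rightarrow>\<^sub>E prefixes E n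
       \<and> (\<forall>x\<in>prefixes D (Suc n). restr E n (f (Suc n) x) = f n (restr D n x))
       \<and> (\<forall>x y. (x, y) \<in> porder D n \<longrightarrow> (f n x, f n y) \<in> porder E n)}"

definition cprod :: "'x causal_poset \<Rightarrow> 'y causal_poset \<Rightarrow> ('x \<times> 'y) causal_poset" where
  "cprod D E =
     \<lparr>prefixes = (\<lambda>n. prefixes D n \<times> prefixes E n),
      restr = (\<lambda>n (x, y). (restr D n x, restr E n y)),
      porder = (\<lambda>n. {((x, y), (x', y')). (x, x') \<in> porder D n \<and> (y, y') \<in> porder E n})\<rparr>"

section \<open>Internal local least fixed points\<close>

text \<open>Restriction from stage \<open>m + k\<close> down to stage \<open>m\<close>.\<close>

primrec restr_down :: "'x causal_poset \<Rightarrow> nat \<Rightarrow> nat \<Rightarrow> 'x \<Rightarrow> 'x" where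
  "restr_down D m 0 x = x"
| "restr_down D m (Suc k) x = restr_down D m k (restr D (m + k) x)"

definition is_lfp_at ::
  "'x causal_poset \<Rightarrow> (nat \<Rightarrow> 'a \<times> 'x \<Rightarrow> 'x) \<Rightarrow> nat \<Rightarrow> 'a \<Rightarrow> 'x \<Rightarrow> bool" where
  "is_lfp_at X f n a x \<longleftrightarrow>
     is_least {y \<in> prefixes X n. f n (a, y) = y} (porder X n) x"

text \<open>
  The Kripke--Joyal reading at stage \<open>n\<close> of ``\<open>x\<close> is the least fixed point of \<open>f (a, -)\<close>'':
  the property has to hold for the restrictions of \<open>a\<close> and \<open>x\<close> to every stage \<open>m \<le> n\<close>.
\<close>

definition is_internal_lfp ::
  "'a causal_poset \<Rightarrow> 'x causal_poset \<Rightarrow> (nat \<Rightarrow> 'a \<times> 'x \<Rightarrow> 'x) \<Rightarrow> nat \<Rightarrow> 'a \<Rightarrow> 'x \<Rightarrow> bool" where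
  "is_internal_lfp A X f n a x \<longleftrightarrow>
     (\<forall>m k. m + k = n \<longrightarrow> is_lfp_at X f m (restr_down A m k a) (restr_down X m k x))"

definition mu ::
  "'a causal_poset \<Rightarrow> 'x causal_poset \<Rightarrow> (nat \<Rightarrow> 'a \<times> 'x \<Rightarrow> 'x) \<Rightarrow> nat \<Rightarrow> 'a \<Rightarrow> 'x" where
  "mu A X f n = (\<lambda>a\<in>prefixes A n. THE x. is_internal_lfp A X f n a x)"

subsection \<open>The fixed point exists, is unique, and depends on the parameter in an increasing causal way\<close>

lemma is_least_unique:
  assumes "antisym r" "is_least S r x" "is_least S r y" shows "x = y"
  using assms unfolding is_least_def antisym_def by blast

lemma internal_bhdD:
  assumes "internal_bhd D"
  shows internal_bhd_mem: "\<And>n x y. (x, y) \<in> porder D n \<Longrightarrow> x \<in> prefixes D n \<and> y \<in> prefixes D n"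
    and internal_bhd_refl: "\<And>n x. x \<in> prefixes D n \<Longrightarrow> (x, x) \<in> porder D n"
    and internal_bhd_trans:
      "\<And>n x y z. (x, y) \<in> porder D n \<Longrightarrow> (y, z) \<in> porder D n \<Longrightarrow> (x, z) \<in> porder D n"
    and internal_bhd_antisym: "\<And>n. antisym (porder D n)"
    and internal_bhd_least: "\<And>n. \<exists>x. is_least (prefixes D n) (porder D n) x"
    and internal_bhd_bounded: "\<And>n. bounded_height (prefixes D n) (porder D n)"
    and internal_bhd_restr: "\<And>n x. x \<in> prefixes D (Suc n) \<Longrightarrow> restr D n x \<in> prefixes D n"
    and internal_bhd_restr_least: "\<And>n x. is_least (prefixes D (Suc n)) (porder D (Suc n)) x
           \<Longrightarrow> is_least (prefixes D n) (porder D n) (restr D n x)"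
  subgoal using assms unfolding internal_bhd_def partial_order_on_def preorder_on_def by blast
  subgoal using assms unfolding internal_bhd_def partial_order_on_def preorder_on_def refl_on_def by blast
  subgoal using assms unfolding internal_bhd_def partial_order_on_def preorder_on_def trans_def by meson
  subgoal using assms unfolding internal_bhd_def partial_order_on_def by blast
  subgoal using assms unfolding internal_bhd_def by blast
  subgoal using assms unfolding internal_bhd_def by blast
  subgoal using assms unfolding internal_bhd_def by blast
  subgoal using assms unfolding internal_bhd_def by blast
  done

lemma increasing_causalD:
  assumes "f \<in> increasing_causal (cprod A X) X"
  shows incr_mem: "\<And>n a x. a \<in> prefixes A n \<Longrightarrow> x \<in> prefixes X n \<Longrightarrow> f n (a, x) \<in> prefixes X n"
    and incr_restr: "\<And>n a x. a \<in> prefixes A (Suc n) \<Longrightarrow> x \<in> prefixes X (Suc n) \<Longrightarrow>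
          restr X n (f (Suc n) (a, x)) = f n (restr A n a, restr X n x)"
    and incr_mono: "\<And>n a x a' x'. (a, a') \<in> porder A n \<Longrightarrow> (x, x') \<in> porder X n \<Longrightarrow>
          (f n (a, x), f n (a', x')) \<in> porder X n"
  subgoal using assms unfolding increasing_causal_def cprod_def by (auto simp: PiE_iff)
  subgoal using assms unfolding increasing_causal_def cprod_def by (auto simp: PiE_iff)
  subgoal using assms unfolding increasing_causal_def cprod_def by auto
  done

context
  fixes A :: "'a causal_poset" and X :: "'x causal_poset" and f
  assumes A: "internal_bhd A" and X: "internal_bhd X"
    and f: "f \<in> increasing_causal (cprod A X) X"
begin

private definition bt :: "nat \<Rightarrow> 'x" where
  "bt n = (SOME x. is_least (prefixes X n) (porder X n) x)"

private definition it :: "nat \<Rightarrow> 'a \<Rightarrow> nat \<Rightarrow> 'x" where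
  "it n a k = ((\<lambda>x. f n (a, x)) ^^ k) (bt n)"

private lemma bt: "is_least (prefixes X n) (porder X n) (bt n)"
  unfolding bt_def using internal_bhd_least[OF X, of n] by (rule someI_ex)

private lemma restr_bt: "restr X n (bt (Suc n)) = bt n"
  by (rule is_least_unique[OF internal_bhd_antisym[OF X] internal_bhd_restr_least[OF X bt] bt])

private lemma it_Suc: "it n a (Suc k) = f n (a, it n a k)"
  by (simp add: it_def)

private lemma it_mem: "a \<in> prefixes A n \<Longrightarrow> it n a k \<in> prefixes X n"
proof (induction k)
  case 0 then show ?case using bt[of n] by (simp add: it_def is_least_def)
qed (simp add: it_Suc incr_mem[OF f])

private lemma it_chain:
  assumes a: "a \<in> prefixes A n" shows "(it n a k, it n a (Suc k)) \<in> porder X n"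
proof (induction k)
  case 0 show ?case using bt[of n] it_mem[OF a, of 1] by (simp add: it_def is_least_def)
next
  case (Suc k) then show ?case
    by (simp add: it_Suc incr_mono[OF f] internal_bhd_refl[OF A a])
qed

private lemma it_le:
  assumes a: "a \<in> prefixes A n" and "k \<le> l" shows "(it n a k, it n a l) \<in> porder X n"
  using \<open>k \<le> l\<close>
proof (induction l rule: dec_induct)
  case base show ?case by (rule internal_bhd_refl[OF X it_mem[OF a]])
next
  case (step l) then show ?case using internal_bhd_trans[OF X] it_chain[OF a] by blast
qed

private lemma it_least:
  assumes aa: "(a, a') \<in> porder A n" and y: "y \<in> prefixes X n" "f n (a', y) = y"
  shows "(it n a k, y) \<in> porder X n"
proof (induction k)
  case 0 show ?case using bt[of n] y by (simp add: it_def is_least_def)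
next
  case (Suc k) then show ?case using incr_mono[OF f aa, of "it n a k" y] y(2) by (simp add: it_Suc)
qed

private lemma it_fixed:
  assumes a: "a \<in> prefixes A n" shows "\<exists>k. f n (a, it n a k) = it n a k"
proof -
  obtain b where b: "\<And>xs. set xs \<subseteq> prefixes X n \<Longrightarrow> successively (\<lambda>x y. (x, y) \<in> porder X n) xs
      \<Longrightarrow> b < length xs \<Longrightarrow> \<exists>i j. i < j \<and> j < length xs \<and> (xs ! j, xs ! i) \<in> porder X n"
    using internal_bhd_bounded[OF X, of n] unfolding bounded_height_def by blast
  let ?xs = "map (it n a) [0..<Suc b]"
  have "set ?xs \<subseteq> prefixes X n" using it_mem[OF a] by auto
  moreover have "successively (\<lambda>x y. (x, y) \<in> porder X n) ?xs"
    using it_chain[OF a] by (auto simp: successively_conv_nth simp del: upt_Suc)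
  ultimately obtain i j where ij: "i < j" "j < Suc b" "(?xs ! j, ?xs ! i) \<in> porder X n"
    using b[of ?xs] by (auto simp del: upt_Suc)
  then have "(it n a j, it n a i) \<in> porder X n" by (simp del: upt_Suc)
  then have "(it n a (Suc i), it n a i) \<in> porder X n"
    using it_le[OF a, of "Suc i" j] ij(1) internal_bhd_trans[OF X] by (meson Suc_leI)
  then have "it n a (Suc i) = it n a i"
    using it_chain[OF a, of i] internal_bhd_antisym[OF X, of n] by (meson antisymD)
  then show ?thesis by (auto simp: it_Suc)
qed

private lemma it_restr:
  assumes a: "a \<in> prefixes A (Suc n)"
  shows "restr X n (it (Suc n) a k) = it n (restr A n a) k"
proof (induction k)
  case 0 show ?case by (simp add: it_def restr_bt)
qed (simp add: it_Suc incr_restr[OF f a it_mem[OF a]])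

private lemma it_lfp:
  assumes a: "a \<in> prefixes A n" and "f n (a, it n a k) = it n a k"
  shows "is_lfp_at X f n a (it n a k)"
  using assms it_least[OF internal_bhd_refl[OF A a]] it_mem[OF a]
  by (auto simp: is_lfp_at_def is_least_def)

private lemma it_fixed_restr:
  assumes a: "a \<in> prefixes A (Suc n)" and "f (Suc n) (a, it (Suc n) a k) = it (Suc n) a k"
  shows "f n (restr A n a, it n (restr A n a) k) = it n (restr A n a) k"
  using assms incr_restr[OF f a it_mem[OF a], of k] it_restr[OF a, of k] by simp

private lemma it_internal_lfp_aux:
  assumes "a \<in> prefixes A (m + d)" and "f (m + d) (a, it (m + d) a k) = it (m + d) a k"
  shows "is_lfp_at X f m (restr_down A m d a) (restr_down X m d (it (m + d) a k))"
  using assms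
proof (induction d arbitrary: a)
  case 0 then show ?case by (simp add: it_lfp)
next
  case (Suc d)
  then show ?case
    using it_fixed_restr[of a "m + d" k] it_restr[of a "m + d" k] internal_bhd_restr[OF A, of a "m + d"]
    by simp
qed

private lemma it_internal_lfp:
  assumes "a \<in> prefixes A n" and "f n (a, it n a k) = it n a k"
  shows "is_internal_lfp A X f n a (it n a k)"
  using assms it_internal_lfp_aux unfolding is_internal_lfp_def by blast

private lemma internal_lfp_unique:
  assumes "is_internal_lfp A X f n a x" "is_internal_lfp A X f n a y" shows "x = y"
proof -
  have "is_lfp_at X f n a x" "is_lfp_at X f n a y"
    using assms unfolding is_internal_lfp_def by (metis add_0_right restr_down.simps(1))+
  then show ?thesis
    unfolding is_lfp_at_def by (rule is_least_unique[OF internal_bhd_antisym[OF X]])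
qed

private lemma mu_eq:
  assumes "a \<in> prefixes A n" and "f n (a, it n a k) = it n a k"
  shows "mu A X f n a = it n a k"
  unfolding mu_def using assms it_internal_lfp[OF assms] internal_lfp_unique
  by (simp add: the_equality)

lemma mu_internal_lfp:
  assumes "a \<in> prefixes A n" shows "is_internal_lfp A X f n a (mu A X f n a)"
  using it_fixed[OF assms] mu_eq[OF assms] it_internal_lfp[OF assms] by metis

lemma mu_increasing_causal: "mu A X f \<in> increasing_causal A X"
proof -
  have mem: "mu A X f n a \<in> prefixes X n" if a: "a \<in> prefixes A n" for n a
    using it_fixed[OF a] mu_eq[OF a] it_mem[OF a] by metis
  have ext: "mu A X f n \<in> extensional (prefixes A n)" for n
    by (simp add: mu_def)
  have restr: "restr X n (mu A X f (Suc n) a) = mu A X f n (restr A n a)"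
    if a: "a \<in> prefixes A (Suc n)" for n a
  proof -
    obtain k where k: "f (Suc n) (a, it (Suc n) a k) = it (Suc n) a k"
      using it_fixed[OF a] by blast
    show ?thesis
      using mu_eq[OF a k] it_restr[OF a, of k]
        mu_eq[OF internal_bhd_restr[OF A a] it_fixed_restr[OF a k]] by simp
  qed
  have mono: "(mu A X f n a, mu A X f n a') \<in> porder X n" if aa: "(a, a') \<in> porder A n" for n a a'
  proof -
    have a: "a \<in> prefixes A n" and a': "a' \<in> prefixes A n" using internal_bhd_mem[OF A aa] by auto
    obtain k k' where k: "f n (a, it n a k) = it n a k" and k': "f n (a', it n a' k') = it n a' k'"
      using it_fixed[OF a] it_fixed[OF a'] by blast
    show ?thesis
      using it_least[OF aa it_mem[OF a'] k', of k] mu_eq[OF a k] mu_eq[OF a' k'] by simp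
  qed
  show ?thesis using mem ext restr mono unfolding increasing_causal_def by (auto simp: PiE_iff)
qed

end

section \<open>Signals and products of signals\<close>

text \<open>\<open>A\<^sub>\<bottom>\<close>, with \<open>None\<close> as the bottom element.\<close>

definition lifted :: "'a set \<Rightarrow> 'a option set" where
  "lifted A = insert None (Some ` A)"

definition flat_le :: "'a option \<Rightarrow> 'a option \<Rightarrow> bool" where
  "flat_le x y \<longleftrightarrow> x = None \<or> x = y"

definition words :: "nat \<Rightarrow> 'a set \<Rightarrow> 'a option list set" where
  "words n A = {w. length w = n \<and> set w \<subseteq> lifted A}"

definition signal :: "'a set \<Rightarrow> 'a option list causal_poset" where
  "signal A =
     \<lparr>prefixes = (\<lambda>n. words n A),
      restr = (\<lambda>n. butlast),
      porder = (\<lambda>n. {(v, w). v \<in> words n A \<and> w \<in> words n A \<and> list_all2 flat_le v w})\<rparr>"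

text \<open>
  Finite products; an element of stage \<open>n\<close> is the list of its components. With this
  encoding the binary product of two finite products is given by list concatenation.
\<close>

definition tuples :: "nat \<Rightarrow> 'x causal_poset list \<Rightarrow> 'x list set" where
  "tuples n Ds = {xs. list_all2 (\<lambda>x D. x \<in> prefixes D n) xs Ds}"

definition product :: "'x causal_poset list \<Rightarrow> 'x list causal_poset" where
  "product Ds =
     \<lparr>prefixes = (\<lambda>n. tuples n Ds),
      restr = (\<lambda>n xs. map2 (\<lambda>D x. restr D n x) Ds xs),
      porder = (\<lambda>n. {(xs, ys). xs \<in> tuples n Ds \<and> ys \<in> tuples n Ds
                     \<and> (\<forall>i<length Ds. (xs ! i, ys ! i) \<in> porder (Ds ! i) n)})\<rparr>"

type_synonym 'a interface = "'a set list"

definition wires :: "'a interface \<Rightarrow> 'a option list list causal_poset" where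
  "wires As = product (map signal As)"

section \<open>Sequential circuits\<close>

record 'a circuit =
  source :: "'a interface"
  target :: "'a interface"
  fn :: "nat \<Rightarrow> 'a option list list \<Rightarrow> 'a option list list"

definition circuits :: "'a interface \<Rightarrow> 'a interface \<Rightarrow> 'a circuit set" where
  "circuits A B =
     {f. source f = A \<and> target f = B \<and> fn f \<in> increasing_causal (wires A) (wires B)}"

definition ident :: "'a interface \<Rightarrow> 'a circuit" where
  "ident A = \<lparr>source = A, target = A, fn = (\<lambda>n. \<lambda>x\<in>prefixes (wires A) n. x)\<rparr>"

definition cascade :: "'a circuit \<Rightarrow> 'a circuit \<Rightarrow> 'a circuit" where
  "cascade g f = \<lparr>source = source f, target = target g,
               fn = (\<lambda>n. compose (prefixes (wires (source f)) n) (fn g n) (fn f n))\<rparr>"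

text \<open>The cartesian structure: projections and pairing.\<close>

definition proj1 :: "'a interface \<Rightarrow> 'a interface \<Rightarrow> 'a circuit" where
  "proj1 A B = \<lparr>source = A @ B, target = A,
                fn = (\<lambda>n. \<lambda>x\<in>prefixes (wires (A @ B)) n. take (length A) x)\<rparr>"

definition proj2 :: "'a interface \<Rightarrow> 'a interface \<Rightarrow> 'a circuit" where
  "proj2 A B = \<lparr>source = A @ B, target = B,
                fn = (\<lambda>n. \<lambda>x\<in>prefixes (wires (A @ B)) n. drop (length A) x)\<rparr>"

text \<open>\<open>pair f g\<close> is meant for \<open>f\<close> and \<open>g\<close> with the same source.\<close>

definition pair :: "'a circuit \<Rightarrow> 'a circuit \<Rightarrow> 'a circuit" where
  "pair f g = \<lparr>source = source f, target = target f @ target g,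
               fn = (\<lambda>n. \<lambda>x\<in>prefixes (wires (source f)) n. fn f n x @ fn g n x)\<rparr>"

definition tensor :: "'a circuit \<Rightarrow> 'a circuit \<Rightarrow> 'a circuit" where
  "tensor f g = pair (cascade f (proj1 (source f) (source g))) (cascade g (proj2 (source f) (source g)))"

definition swap :: "'a interface \<Rightarrow> 'a interface \<Rightarrow> 'a circuit" where
  "swap A B = pair (proj2 A B) (proj1 A B)"

text \<open>Feedback: @ identifies the pairs of \<open>cprod (wires A) (wires X)\<close> with \<open>wires (A @ X)\<close>.\<close>

definition fixpoint :: "'a interface \<Rightarrow> 'a interface \<Rightarrow> 'a circuit \<Rightarrow> 'a circuit" where
  "fixpoint A X f = \<lparr>source = A, target = X,
     fn = mu (wires A) (wires X)
            (\<lambda>n. \<lambda>(a, x)\<in>prefixes (cprod (wires A) (wires X)) n. fn f n (a @ x))\<rparr>"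

definition feedback :: "'a interface \<Rightarrow> 'a interface \<Rightarrow> 'a interface \<Rightarrow> 'a circuit \<Rightarrow> 'a circuit" where
  "feedback A B X f = cascade (proj1 B X) (cascade f (pair (ident A) (fixpoint A X (cascade (proj2 B X) f))))"

subsection \<open>Interfaces are interpreted by internal bounded height domains\<close>

lemma bounded_height_rank:
  fixes rk :: "'x \<Rightarrow> nat"
  assumes bound: "\<And>x. x \<in> S \<Longrightarrow> rk x \<le> b"
    and tr: "trans r" and rf: "\<And>x. x \<in> S \<Longrightarrow> (x, x) \<in> r"
    and mono: "\<And>x y. (x, y) \<in> r \<Longrightarrow> rk x \<le> rk y"
    and strict: "\<And>x y. (x, y) \<in> r \<Longrightarrow> rk x = rk y \<Longrightarrow> x = y"
  shows "bounded_height S r"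
  unfolding bounded_height_def
proof (rule exI[of _ "Suc b"], intro allI impI)
  fix xs assume xs: "set xs \<subseteq> S" "successively (\<lambda>x y. (x, y) \<in> r) xs" "Suc b < length xs"
  have sorted: "sorted_wrt (\<lambda>x y. (x, y) \<in> r) xs"
  proof -
    have "transp (\<lambda>x y. (x, y) \<in> r)" using tr by (auto intro!: transpI dest: transD)
    then show ?thesis
      using xs(2) successively_iff_sorted_wrt_strong[of xs "\<lambda>x y. (x, y) \<in> r"] by (meson transpD)
  qed
  have "\<not> inj_on (\<lambda>i. rk (xs ! i)) {..<length xs}"
  proof
    assume "inj_on (\<lambda>i. rk (xs ! i)) {..<length xs}"
    moreover have "(\<lambda>i. rk (xs ! i)) ` {..<length xs} \<subseteq> {..b}" using xs(1) bound by (auto simp: subset_iff)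
    ultimately have "card {..<length xs} \<le> card {..b}" by (intro card_inj_on_le) auto
    then show False using xs(3) by simp
  qed
  then obtain i j where ij: "i < j" "j < length xs" "rk (xs ! i) = rk (xs ! j)"
    unfolding inj_on_def by (metis lessThan_iff linorder_neqE_nat)
  then have "(xs ! i, xs ! j) \<in> r" using sorted by (simp add: sorted_wrt_iff_nth_less)
  with ij strict have "xs ! i = xs ! j" by blast
  moreover have "xs ! j \<in> S" using xs(1) nth_mem[OF ij(2)] by blast
  ultimately have "(xs ! j, xs ! i) \<in> r" using rf by simp
  then show "\<exists>i j. i < j \<and> j < length xs \<and> (xs ! j, xs ! i) \<in> r" using ij by blast
qed

lemma wires_simps:
  "prefixes (wires As) n = {xs. list_all2 (\<lambda>x A. x \<in> words n A) xs As}"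
  "restr (wires As) n xs = map2 (\<lambda>A. butlast) As xs"
  "porder (wires As) n = {(xs, ys). xs \<in> prefixes (wires As) n \<and> ys \<in> prefixes (wires As) n
      \<and> list_all2 (list_all2 flat_le) xs ys}"
  subgoal by (simp add: wires_def product_def tuples_def signal_def list_all2_map2)
  subgoal by (simp add: wires_def product_def signal_def zip_map1 split_def)
  subgoal by (auto simp: wires_def product_def tuples_def signal_def list_all2_conv_all_nth)
  done

lemma flat_le_refl: "flat_le x x" by (simp add: flat_le_def)

lemma count_flat:
  assumes "list_all2 flat_le v w"
  shows "length (filter (\<lambda>x. x \<noteq> None) v) \<le> length (filter (\<lambda>x. x \<noteq> None) w)
    \<and> (length (filter (\<lambda>x. x \<noteq> None) v) = length (filter (\<lambda>x. x \<noteq> None) w) \<longrightarrow> v = w)"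
  using assms by (induction rule: list_all2_induct) (auto simp: flat_le_def)

lemma count_flats:
  assumes "list_all2 (list_all2 flat_le) xs ys"
  shows "length (filter (\<lambda>x. x \<noteq> None) (concat xs)) \<le> length (filter (\<lambda>x. x \<noteq> None) (concat ys))
    \<and> (length (filter (\<lambda>x. x \<noteq> None) (concat xs)) = length (filter (\<lambda>x. x \<noteq> None) (concat ys)) \<longrightarrow> xs = ys)"
  using assms
proof (induction rule: list_all2_induct)
  case (Cons x xs y ys)
  then show ?case using count_flat[OF Cons(1)] by auto
qed simp

lemma internal_bhd_wires: "internal_bhd (wires As)"
proof -
  have po: "partial_order_on (prefixes (wires As) n) (porder (wires As) n)" for n
    unfolding partial_order_on_def preorder_on_def
  proof (intro conjI)
    show "refl_on (prefixes (wires As) n) (porder (wires As) n)"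
      by (auto simp: refl_on_def wires_simps(3) intro!: list_all2_refl flat_le_refl)
    show "trans (porder (wires As) n)"
    proof -
      have "transp flat_le" by (auto simp: flat_le_def transp_def)
      then have "transp (list_all2 (list_all2 flat_le))" by (intro list.rel_transp)
      then show ?thesis unfolding trans_def wires_simps(3) by (auto dest: transpD)
    qed
    show "antisym (porder (wires As) n)"
      unfolding antisym_def wires_simps(3) using count_flats by (blast intro: le_antisym)
    show "porder (wires As) n \<subseteq> prefixes (wires As) n \<times> prefixes (wires As) n"
      by (auto simp: wires_simps(3))
  qed
  let ?rk = "\<lambda>xs. length (filter (\<lambda>x. x \<noteq> None) (concat xs))"
  have bh: "bounded_height (prefixes (wires As) n) (porder (wires As) n)" for n
  proof (rule bounded_height_rank)
    fix xs assume "xs \<in> prefixes (wires As) n"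
    then have "list_all2 (\<lambda>x A. x \<in> words n A) xs As" by (simp add: wires_simps)
    then have "length (concat xs) = n * length As"
      by (induction rule: list_all2_induct) (auto simp: words_def)
    then show "?rk xs \<le> n * length As" by (metis length_filter_le)
  next
    show "trans (porder (wires As) n)" using po unfolding partial_order_on_def preorder_on_def by blast
    show "(x, x) \<in> porder (wires As) n" if "x \<in> prefixes (wires As) n" for x
      using po that unfolding partial_order_on_def preorder_on_def refl_on_def by blast
  qed (use count_flats in \<open>auto simp: wires_simps(3)\<close>)
  let ?bot = "\<lambda>n. replicate (length As) (replicate n None)"
  have bot: "is_least (prefixes (wires As) n) (porder (wires As) n) (?bot n)" for n
    unfolding is_least_def wires_simps
    by (auto simp: list_all2_conv_all_nth words_def lifted_def flat_le_def)
  have restr: "restr (wires As) n xs \<in> prefixes (wires As) n"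
    if "xs \<in> prefixes (wires As) (Suc n)" for n xs
    using that by (fastforce simp: wires_simps list_all2_conv_all_nth words_def dest: in_set_butlastD)
  have rmono: "(restr (wires As) n xs, restr (wires As) n ys) \<in> porder (wires As) n"
    if "(xs, ys) \<in> porder (wires As) (Suc n)" for n xs ys
  proof -
    have "xs \<in> prefixes (wires As) (Suc n)" "ys \<in> prefixes (wires As) (Suc n)"
      "list_all2 (list_all2 flat_le) xs ys" using that by (auto simp: wires_simps(3))
    then show ?thesis unfolding wires_simps(3) using restr[of xs n] restr[of ys n]
      by (auto simp: wires_simps(1,2) list_all2_conv_all_nth nth_butlast)
  qed
  have rbot: "restr (wires As) n (?bot (Suc n)) = ?bot n" for n
    by (rule nth_equalityI) (auto simp: wires_simps butlast_conv_take simp flip: replicate_Suc)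
  have rleast: "is_least (prefixes (wires As) n) (porder (wires As) n) (restr (wires As) n x)"
    if "is_least (prefixes (wires As) (Suc n)) (porder (wires As) (Suc n)) x" for n x
  proof -
    have "x = ?bot (Suc n)"
      using is_least_unique[OF _ that bot] po[of "Suc n"] unfolding partial_order_on_def by blast
    then show ?thesis using bot[of n] rbot[of n] by simp
  qed
  show ?thesis unfolding internal_bhd_def using po bh bot restr rmono rleast by blast
qed

subsection \<open>The fixed points of circuits are internal least fixed points\<close>

lemma wires_append:
  assumes "a \<in> prefixes (wires A) n" "a' \<in> prefixes (wires A) n"
  shows wires_append_mem: "a @ x \<in> prefixes (wires (A @ X)) n \<longleftrightarrow> x \<in> prefixes (wires X) n"
    and wires_append_restr: "restr (wires (A @ X)) m (a @ x) = restr (wires A) m a @ restr (wires X) m x"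
    and wires_append_le: "(a @ x, a' @ x') \<in> porder (wires (A @ X)) n
      \<longleftrightarrow> (a, a') \<in> porder (wires A) n \<and> (x, x') \<in> porder (wires X) n"
proof -
  have l: "length a = length A" "length a' = length A"
    using assms by (auto simp: wires_simps(1) dest: list_all2_lengthD)
  show "a @ x \<in> prefixes (wires (A @ X)) n \<longleftrightarrow> x \<in> prefixes (wires X) n"
    using assms l by (simp add: wires_simps(1) list_all2_append)
  show "restr (wires (A @ X)) m (a @ x) = restr (wires A) m a @ restr (wires X) m x"
    using l by (simp add: wires_simps(2))
  show "(a @ x, a' @ x') \<in> porder (wires (A @ X)) n
      \<longleftrightarrow> (a, a') \<in> porder (wires A) n \<and> (x, x') \<in> porder (wires X) n"
    using assms l by (auto simp: wires_simps(1,3) list_all2_append)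
qed

lemma uncurried_circuit:
  assumes "f \<in> circuits (A @ X) B"
  shows "(\<lambda>n. \<lambda>(a, x)\<in>prefixes (cprod (wires A) (wires X)) n. fn f n (a @ x))
           \<in> increasing_causal (cprod (wires A) (wires X)) (wires B)" (is "?g \<in> _")
proof -
  have f: "fn f n \<in> prefixes (wires (A @ X)) n \<rightarrow>\<^sub>E prefixes (wires B) n"
    "\<And>x. x \<in> prefixes (wires (A @ X)) (Suc n) \<Longrightarrow>
       restr (wires B) n (fn f (Suc n) x) = fn f n (restr (wires (A @ X)) n x)"
    "\<And>x y. (x, y) \<in> porder (wires (A @ X)) n \<Longrightarrow> (fn f n x, fn f n y) \<in> porder (wires B) n" for n
    using assms unfolding circuits_def increasing_causal_def by auto
  have r: "restr (wires C) n c \<in> prefixes (wires C) n" if "c \<in> prefixes (wires C) (Suc n)" for C n c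
    using internal_bhd_restr[OF internal_bhd_wires that] .
  have m: "x \<in> prefixes (wires C) n \<and> y \<in> prefixes (wires C) n" if "(x, y) \<in> porder (wires C) n" for C n x y
    using internal_bhd_mem[OF internal_bhd_wires that] .
  have g: "?g n (a, x) = fn f n (a @ x)" if "a \<in> prefixes (wires A) n" "x \<in> prefixes (wires X) n" for n a x
    using that by (simp add: cprod_def)
  have "?g n \<in> prefixes (cprod (wires A) (wires X)) n \<rightarrow>\<^sub>E prefixes (wires B) n" for n
    using f(1)[of n] by (auto simp: PiE_iff cprod_def wires_append_mem)
  moreover have "restr (wires B) n (?g (Suc n) z) = ?g n (restr (cprod (wires A) (wires X)) n z)"
    if z: "z \<in> prefixes (cprod (wires A) (wires X)) (Suc n)" for n z
  proof -
    obtain a x where ax: "z = (a, x)" "a \<in> prefixes (wires A) (Suc n)" "x \<in> prefixes (wires X) (Suc n)"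
      using z by (auto simp: cprod_def)
    have "restr (wires B) n (?g (Suc n) z) = fn f n (restr (wires A) n a @ restr (wires X) n x)"
      using ax f(2)[of "a @ x" n] wires_append_mem[OF ax(2,2), of x X]
        wires_append_restr[OF ax(2,2), of X n x] g[OF ax(2,3)] by simp
    also have "\<dots> = ?g n (restr (cprod (wires A) (wires X)) n z)"
      using g[OF r[OF ax(2)] r[OF ax(3)]] ax(1) by (simp add: cprod_def)
    finally show ?thesis .
  qed
  moreover have "(?g n z, ?g n z') \<in> porder (wires B) n"
    if zz': "(z, z') \<in> porder (cprod (wires A) (wires X)) n" for n z z'
  proof -
    obtain a x a' x' where zz: "z = (a, x)" "z' = (a', x')"
      and le: "(a, a') \<in> porder (wires A) n" "(x, x') \<in> porder (wires X) n"
      using zz' by (cases z; cases z') (auto simp: cprod_def)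
    show ?thesis
      using m[OF le(1)] m[OF le(2)] le zz f(3)[of "a @ x" "a' @ x'" n]
        wires_append_le[of a A n a' x x' X] g[of a n x] g[of a' n x'] by simp
  qed
  ultimately show ?thesis unfolding increasing_causal_def by blast
qed

lemma fixpoint_circuit:
  assumes "f \<in> circuits (A @ X) X"
  shows "fixpoint A X f \<in> circuits A X"
    and "a \<in> prefixes (wires A) n \<Longrightarrow>
      is_internal_lfp (wires A) (wires X)
        (\<lambda>n. \<lambda>(a, x)\<in>prefixes (cprod (wires A) (wires X)) n. fn f n (a @ x)) n a
        (fn (fixpoint A X f) n a)"
  using mu_increasing_causal[OF internal_bhd_wires internal_bhd_wires uncurried_circuit[OF assms]]
    mu_internal_lfp[OF internal_bhd_wires internal_bhd_wires uncurried_circuit[OF assms]]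
  by (simp_all add: circuits_def fixpoint_def)

section \<open>Traced monoidal categories\<close>

text \<open>
  The laws of Joyal, Street and Verity for a strict symmetric monoidal category (with trivial
  twist), all elements of type \<open>'o\<close> being objects. The circuits form a strict category because
  the product of interfaces is concatenation of lists.
\<close>

locale symmetric_monoidal_category =
  fixes Hom :: "'o \<Rightarrow> 'o \<Rightarrow> 'm set"
    and Id :: "'o \<Rightarrow> 'm"
    and Comp :: "'m \<Rightarrow> 'm \<Rightarrow> 'm" (infixl "\<cdot>" 55)
    and Ten :: "'o \<Rightarrow> 'o \<Rightarrow> 'o" (infixl "\<odot>" 70)
    and Unit :: 'o
    and TenM :: "'m \<Rightarrow> 'm \<Rightarrow> 'm" (infixl "\<otimes>" 70)
    and Sym :: "'o \<Rightarrow> 'o \<Rightarrow> 'm"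
  assumes id_hom: "Id A \<in> Hom A A"
    and comp_hom: "f \<in> Hom A B \<Longrightarrow> g \<in> Hom B C \<Longrightarrow> g \<cdot> f \<in> Hom A C"
    and id_left: "f \<in> Hom A B \<Longrightarrow> Id B \<cdot> f = f"
    and id_right: "f \<in> Hom A B \<Longrightarrow> f \<cdot> Id A = f"
    and comp_assoc: "f \<in> Hom A B \<Longrightarrow> g \<in> Hom B C \<Longrightarrow> h \<in> Hom C D \<Longrightarrow> (h \<cdot> g) \<cdot> f = h \<cdot> (g \<cdot> f)"
    and tensor_hom: "f \<in> Hom A B \<Longrightarrow> g \<in> Hom C D \<Longrightarrow> f \<otimes> g \<in> Hom (A \<odot> C) (B \<odot> D)"
    and tensor_id: "Id A \<otimes> Id B = Id (A \<odot> B)"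
    and interchange: "f \<in> Hom A B \<Longrightarrow> f' \<in> Hom B C \<Longrightarrow> g \<in> Hom A' B' \<Longrightarrow> g' \<in> Hom B' C' \<Longrightarrow>
      (f' \<cdot> f) \<otimes> (g' \<cdot> g) = (f' \<otimes> g') \<cdot> (f \<otimes> g)"
    and ten_assoc: "(A \<odot> B) \<odot> C = A \<odot> (B \<odot> C)"
    and ten_unit_left: "Unit \<odot> A = A"
    and ten_unit_right: "A \<odot> Unit = A"
    and tensor_assoc: "f \<in> Hom A A' \<Longrightarrow> g \<in> Hom B B' \<Longrightarrow> h \<in> Hom C C' \<Longrightarrow>
      (f \<otimes> g) \<otimes> h = f \<otimes> (g \<otimes> h)"
    and tensor_unit_left: "f \<in> Hom A B \<Longrightarrow> Id Unit \<otimes> f = f"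
    and tensor_unit_right: "f \<in> Hom A B \<Longrightarrow> f \<otimes> Id Unit = f"
    and sym_hom: "Sym A B \<in> Hom (A \<odot> B) (B \<odot> A)"
    and sym_natural: "f \<in> Hom A A' \<Longrightarrow> g \<in> Hom B B' \<Longrightarrow>
      Sym A' B' \<cdot> (f \<otimes> g) = (g \<otimes> f) \<cdot> Sym A B"
    and sym_inverse: "Sym B A \<cdot> Sym A B = Id (A \<odot> B)"
    and hexagon: "Sym A (B \<odot> C) = (Id B \<otimes> Sym A C) \<cdot> (Sym A B \<otimes> Id C)"

locale traced_monoidal_category = symmetric_monoidal_category +
  fixes Tr :: "'a \<Rightarrow> 'a \<Rightarrow> 'a \<Rightarrow> 'b \<Rightarrow> 'b"
  assumes trace_hom: "f \<in> Hom (A \<odot> X) (B \<odot> X) \<Longrightarrow> Tr A B X f \<in> Hom A B"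
    and natural_source: "f \<in> Hom (A \<odot> X) (B \<odot> X) \<Longrightarrow> g \<in> Hom A' A \<Longrightarrow>
      Tr A' B X (f \<cdot> (g \<otimes> Id X)) = Tr A B X f \<cdot> g"
    and natural_target: "f \<in> Hom (A \<odot> X) (B \<odot> X) \<Longrightarrow> g \<in> Hom B B' \<Longrightarrow>
      Tr A B' X ((g \<otimes> Id X) \<cdot> f) = g \<cdot> Tr A B X f"
    and dinatural: "f \<in> Hom (A \<odot> X) (B \<odot> Y) \<Longrightarrow> h \<in> Hom Y X \<Longrightarrow>
      Tr A B X ((Id B \<otimes> h) \<cdot> f) = Tr A B Y (f \<cdot> (Id A \<otimes> h))"
    and vanishing_unit: "f \<in> Hom (A \<odot> Unit) (B \<odot> Unit) \<Longrightarrow> Tr A B Unit f = f"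
    and vanishing_tensor: "f \<in> Hom (A \<odot> (X \<odot> Y)) (B \<odot> (X \<odot> Y)) \<Longrightarrow>
      Tr A B (X \<odot> Y) f = Tr A B X (Tr (A \<odot> X) (B \<odot> X) Y f)"
    and superposing: "f \<in> Hom (A \<odot> X) (B \<odot> X) \<Longrightarrow> g \<in> Hom C D \<Longrightarrow>
      Tr (A \<odot> C) (B \<odot> D) X ((Id B \<otimes> Sym X D) \<cdot> (f \<otimes> g) \<cdot> (Id A \<otimes> Sym C X)) = Tr A B X f \<otimes> g"
    and yanking: "Tr X X X (Sym X X) = Id X"

end

theory Submission
  imports Defs
begin

text \<open>
  An internal least fixed point is in particular the least fixed point at its own stage, so the
  value of a feedback at a point of a stage is determined there by an ordinary least fixed point
  in a poset of bounded height, and every law reduces to a classical comparison of least fixed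
  points. Bounded height makes the iteration from the bottom element stationary, so a least fixed
  point is also the least pre-fixed point; only vanishing for a product of interfaces needs this.
\<close>

section \<open>Least pre-fixed points in posets of bounded height\<close>

lemma is_least_fixed_le_prefixed:
  assumes po: "partial_order_on S r" and bh: "bounded_height S r" and bot: "is_least S r z"
    and g: "\<And>x. x \<in> S \<Longrightarrow> g x \<in> S" and mono: "\<And>x y. (x, y) \<in> r \<Longrightarrow> (g x, g y) \<in> r"
    and x: "is_least {y \<in> S. g y = y} r x" and p: "p \<in> S" "(g p, p) \<in> r"
  shows "(x, p) \<in> r"
proof -
  have tr: "trans r" and anti: "antisym r" and rf: "\<And>x. x \<in> S \<Longrightarrow> (x, x) \<in> r"
    using po unfolding partial_order_on_def preorder_on_def refl_on_def by auto
  \<comment> \<open>The iterates of \<open>g\<close> from the bottom element form an increasing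
    chain, and every pre-fixed point bounds them from above.\<close>
  define s where "s k = (g ^^ k) z" for k
  have s: "s 0 = z" "s (Suc k) = g (s k)" for k by (simp_all add: s_def)
  have mem: "s k \<in> S" for k
    by (induction k) (use bot g in \<open>auto simp: s is_least_def\<close>)
  have le_p: "(s k, p) \<in> r" for k
  proof (induction k)
    case 0 show ?case using bot p(1) by (simp add: s is_least_def)
  next
    case (Suc k) show ?case unfolding s using transD[OF tr mono[OF Suc] p(2)] .
  qed
  have chain: "(s k, s (Suc k)) \<in> r" for k
  proof (induction k)
    case 0 show ?case using bot mem[of 1] by (simp add: s is_least_def)
  next
    case (Suc k) show ?case using mono[OF Suc] by (simp add: s)
  qed
  have le: "(s k, s l) \<in> r" if "k \<le> l" for k l
    using that
  proof (induction l rule: dec_induct)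
    case base show ?case using rf[OF mem] .
  next
    case (step l) show ?case using transD[OF tr step.IH chain] .
  qed
  obtain b where b: "\<And>xs. set xs \<subseteq> S \<Longrightarrow> successively (\<lambda>x y. (x, y) \<in> r) xs \<Longrightarrow> b < length xs
      \<Longrightarrow> \<exists>i j. i < j \<and> j < length xs \<and> (xs ! j, xs ! i) \<in> r"
    using bh unfolding bounded_height_def by blast
  \<comment> \<open>With \<open>Suc b\<close> entries the list is just longer than the bound, so
    some later iterate lies below an earlier one.\<close>
  let ?xs = "map s [0..<Suc b]"
  have "set ?xs \<subseteq> S" using mem by auto
  moreover have "successively (\<lambda>x y. (x, y) \<in> r) ?xs"
    using chain by (auto simp: successively_conv_nth simp del: upt_Suc)
  ultimately obtain i j where ij: "i < j" "j < Suc b" "(?xs ! j, ?xs ! i) \<in> r"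
    using b[of ?xs] by (auto simp del: upt_Suc)
  \<comment> \<open>Since \<open>Suc i \<le> j\<close>, the iterate \<open>s (Suc i)\<close> lies
    below \<open>s j\<close>, hence below \<open>s i\<close>: the chain is stationary from
    \<open>i\<close> on.\<close>
  then have "(s (Suc i), s i) \<in> r"
    using transD[OF tr le[of "Suc i" j]] by (auto simp del: upt_Suc)
  then have "g (s i) = s i"
    using antisymD[OF anti chain] s(2) by metis
  \<comment> \<open>The iterate \<open>s i\<close> is now a genuine fixed point, so it links
    \<open>x\<close>, which is least among fixed points only, to the pre-fixed point
    \<open>p\<close>.\<close>
  then have "(x, s i) \<in> r" using x mem by (simp add: is_least_def)
  then show ?thesis using transD[OF tr _ le_p] by blast
qed

section \<open>Pointwise description of circuits\<close>

abbreviation stage :: "'a interface \<Rightarrow> nat \<Rightarrow> 'a option list list set" where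
  "stage A n \<equiv> prefixes (wires A) n"

abbreviation stage_le :: "'a interface \<Rightarrow> nat \<Rightarrow> 'a option list list rel" where
  "stage_le A n \<equiv> porder (wires A) n"

section \<open>Splitting and joining tuples at a stage\<close>

lemma stage_length: "x \<in> stage A n \<Longrightarrow> length x = length A"
  by (auto simp: wires_simps(1) dest: list_all2_lengthD)

lemma stage_Nil [simp]: "x \<in> stage [] n \<longleftrightarrow> x = []"
  by (simp add: wires_simps(1))

text \<open>The hypothesis on \<open>a\<close> fixes where the concatenation is cut, so that
  membership can be used as a conditional rewrite rule.\<close>

lemma stage_append [simp]: "a \<in> stage A n \<Longrightarrow> a @ x \<in> stage (A @ X) n \<longleftrightarrow> x \<in> stage X n"
  using wires_append_mem[of a A n a x X] by simp

lemma stage_appendE: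
  assumes "z \<in> stage (A @ X) n"
  obtains a x where "z = a @ x" "a \<in> stage A n" "x \<in> stage X n"
  using assms by (auto simp: wires_simps(1) list_all2_append2)

text \<open>Both left parts have the length of \<open>A\<close>. This is the injectivity of pairing
  in the list encoding; it compares two decompositions of one circuit output.\<close>

lemma stage_append_eq: "a \<in> stage A n \<Longrightarrow> a' \<in> stage A n \<Longrightarrow> a @ x = a' @ x' \<longleftrightarrow> a = a' \<and> x = x'"
  by (simp add: stage_length)

lemma restr_stage: "x \<in> stage A (Suc n) \<Longrightarrow> restr (wires A) n x \<in> stage A n"
  using internal_bhd_restr[OF internal_bhd_wires] .

lemma restr_append:
  "a \<in> stage A n \<Longrightarrow> restr (wires (A @ X)) m (a @ x) = restr (wires A) m a @ restr (wires X) m x"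
  using wires_append_restr[of a A n a X m x] by simp

lemma stage_leD: "(x, y) \<in> stage_le A n \<Longrightarrow> x \<in> stage A n \<and> y \<in> stage A n"
  using internal_bhd_mem[OF internal_bhd_wires] .

lemma stage_le_refl: "x \<in> stage A n \<Longrightarrow> (x, x) \<in> stage_le A n"
  using internal_bhd_refl[OF internal_bhd_wires] .

lemma stage_le_antisym: "(x, y) \<in> stage_le A n \<Longrightarrow> (y, x) \<in> stage_le A n \<Longrightarrow> x = y"
  using antisymD[OF internal_bhd_antisym[OF internal_bhd_wires]] .

lemma stage_le_append:
  "a \<in> stage A n \<Longrightarrow> a' \<in> stage A n \<Longrightarrow>
    (a @ x, a' @ x') \<in> stage_le (A @ X) n \<longleftrightarrow> (a, a') \<in> stage_le A n \<and> (x, x') \<in> stage_le X n"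
  by (rule wires_append_le)

lemma stage_le_appendE:
  assumes "(z, z') \<in> stage_le (A @ X) n"
  obtains a x a' x' where "z = a @ x" "z' = a' @ x'" "(a, a') \<in> stage_le A n" "(x, x') \<in> stage_le X n"
proof -
  obtain a x a' x' where z: "z = a @ x" "z' = a' @ x'" "a \<in> stage A n" "a' \<in> stage A n"
    using stage_leD[OF assms] by (metis stage_appendE)
  then show ?thesis using that assms stage_le_append[OF z(3,4)] by blast
qed

section \<open>Circuits as stagewise functions\<close>

lemma circuitsI:
  assumes "source f = A" "target f = B"
    and "\<And>n. fn f n \<in> extensional (stage A n)"
    and "\<And>n x. x \<in> stage A n \<Longrightarrow> fn f n x \<in> stage B n"
    and "\<And>n x. x \<in> stage A (Suc n) \<Longrightarrow>
      restr (wires B) n (fn f (Suc n) x) = fn f n (restr (wires A) n x)"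
    and "\<And>n x y. (x, y) \<in> stage_le A n \<Longrightarrow> (fn f n x, fn f n y) \<in> stage_le B n"
  shows "f \<in> circuits A B"
  using assms unfolding circuits_def increasing_causal_def by (auto simp: PiE_iff)

lemma circuitsD:
  assumes "f \<in> circuits A B"
  shows circuit_source: "source f = A" and circuit_target: "target f = B"
    and circuit_ext: "fn f n \<in> extensional (stage A n)"
    and circuit_stage: "x \<in> stage A n \<Longrightarrow> fn f n x \<in> stage B n"
    and circuit_restr: "x \<in> stage A (Suc n) \<Longrightarrow>
      restr (wires B) n (fn f (Suc n) x) = fn f n (restr (wires A) n x)"
    and circuit_mono: "(x, y) \<in> stage_le A n \<Longrightarrow> (fn f n x, fn f n y) \<in> stage_le B n"
  using assms unfolding circuits_def increasing_causal_def by (auto simp: PiE_iff)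

lemma circuit_appendE:
  assumes "f \<in> circuits A (B @ X)" "a \<in> stage A n"
  obtains b x where "fn f n a = b @ x" "b \<in> stage B n" "x \<in> stage X n"
  using circuit_stage[OF assms] by (rule stage_appendE)

text \<open>Both functions are \<open>undefined\<close> outside the stage, and the interfaces
  recorded in the two circuits are forced by membership. Every law is thereby reduced to an equation
  at a single point of a single stage.\<close>

lemma circuit_eqI:
  assumes f: "f \<in> circuits A B" and g: "g \<in> circuits A B"
    and eq: "\<And>n x. x \<in> stage A n \<Longrightarrow> fn f n x = fn g n x"
  shows "f = g"
proof -
  have "fn f = fn g"
    using extensionalityI[OF circuit_ext[OF f] circuit_ext[OF g] eq] by blast
  then show ?thesis
    using circuit_source[OF f] circuit_source[OF g] circuit_target[OF f] circuit_target[OF g] by simp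
qed

subsection \<open>The cartesian structure\<close>

lemma ident_circuit: "ident A \<in> circuits A A"
  by (rule circuitsI) (auto simp: ident_def restr_stage dest: stage_leD)

lemma fn_ident: "x \<in> stage A n \<Longrightarrow> fn (ident A) n x = x"
  by (simp add: ident_def)

lemma cascade_circuit:
  assumes f: "f \<in> circuits A B" and g: "g \<in> circuits B C"
  shows "cascade g f \<in> circuits A C"
proof (rule circuitsI)
  show "source (cascade g f) = A" "target (cascade g f) = C"
    using circuitsD(1)[OF f] circuitsD(2)[OF g] by (simp_all add: cascade_def)
  show "fn (cascade g f) n \<in> extensional (stage A n)" for n
    using circuitsD(1)[OF f] by (simp add: cascade_def)
next
  fix n x assume "x \<in> stage A n"
  then show "fn (cascade g f) n x \<in> stage C n"
    using circuitsD(1,4)[OF f] circuitsD(4)[OF g] by (simp add: cascade_def compose_eq)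
next
  fix n x assume "x \<in> stage A (Suc n)"
  then show "restr (wires C) n (fn (cascade g f) (Suc n) x) = fn (cascade g f) n (restr (wires A) n x)"
    using circuitsD(1,4,5)[OF f] circuitsD(5)[OF g] by (simp add: cascade_def compose_eq restr_stage)
next
  fix n x y assume "(x, y) \<in> stage_le A n"
  then show "(fn (cascade g f) n x, fn (cascade g f) n y) \<in> stage_le C n"
    using circuitsD(1,6)[OF f] circuitsD(6)[OF g] stage_leD[of x y A n]
    by (simp add: cascade_def compose_eq)
qed

lemma fn_cascade: "f \<in> circuits A B \<Longrightarrow> x \<in> stage A n \<Longrightarrow> fn (cascade g f) n x = fn g n (fn f n x)"
  by (simp add: cascade_def compose_eq circuit_source)

lemma fn_proj1: "a \<in> stage A n \<Longrightarrow> b \<in> stage B n \<Longrightarrow> fn (proj1 A B) n (a @ b) = a"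
  by (simp add: proj1_def stage_length)

lemma fn_proj2: "a \<in> stage A n \<Longrightarrow> b \<in> stage B n \<Longrightarrow> fn (proj2 A B) n (a @ b) = b"
  by (simp add: proj2_def stage_length)

lemma proj1_circuit: "proj1 A B \<in> circuits (A @ B) A"
proof (rule circuitsI)
  show "source (proj1 A B) = A @ B" "target (proj1 A B) = A"
    and "fn (proj1 A B) n \<in> extensional (stage (A @ B) n)" for n
    by (simp_all add: proj1_def)
next
  fix n x assume "x \<in> stage (A @ B) n"
  then show "fn (proj1 A B) n x \<in> stage A n" by (elim stage_appendE) (simp add: fn_proj1)
next
  fix n x assume "x \<in> stage (A @ B) (Suc n)"
  then show "restr (wires A) n (fn (proj1 A B) (Suc n) x) = fn (proj1 A B) n (restr (wires (A @ B)) n x)"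
    by (elim stage_appendE) (simp add: fn_proj1 restr_append restr_stage)
next
  fix n x y assume "(x, y) \<in> stage_le (A @ B) n"
  then show "(fn (proj1 A B) n x, fn (proj1 A B) n y) \<in> stage_le A n"
    by (elim stage_le_appendE) (simp add: fn_proj1 stage_leD)
qed

lemma proj2_circuit: "proj2 A B \<in> circuits (A @ B) B"
proof (rule circuitsI)
  show "source (proj2 A B) = A @ B" "target (proj2 A B) = B"
    and "fn (proj2 A B) n \<in> extensional (stage (A @ B) n)" for n
    by (simp_all add: proj2_def)
next
  fix n x assume "x \<in> stage (A @ B) n"
  then show "fn (proj2 A B) n x \<in> stage B n" by (elim stage_appendE) (simp add: fn_proj2)
next
  fix n x assume "x \<in> stage (A @ B) (Suc n)"
  then show "restr (wires B) n (fn (proj2 A B) (Suc n) x) = fn (proj2 A B) n (restr (wires (A @ B)) n x)"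
    by (elim stage_appendE) (simp add: fn_proj2 restr_append restr_stage)
next
  fix n x y assume "(x, y) \<in> stage_le (A @ B) n"
  then show "(fn (proj2 A B) n x, fn (proj2 A B) n y) \<in> stage_le B n"
    by (elim stage_le_appendE) (simp add: fn_proj2 stage_leD)
qed

lemma fn_pair: "f \<in> circuits A B \<Longrightarrow> x \<in> stage A n \<Longrightarrow> fn (pair f g) n x = fn f n x @ fn g n x"
  by (simp add: pair_def circuit_source)

lemma pair_circuit:
  assumes f: "f \<in> circuits A B" and g: "g \<in> circuits A C"
  shows "pair f g \<in> circuits A (B @ C)"
proof (rule circuitsI)
  show "source (pair f g) = A" "target (pair f g) = B @ C"
    and "fn (pair f g) n \<in> extensional (stage A n)" for n
    using circuitsD(1,2)[OF f] circuitsD(2)[OF g] by (simp_all add: pair_def)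
next
  fix n x assume "x \<in> stage A n"
  then show "fn (pair f g) n x \<in> stage (B @ C) n"
    using circuitsD(4)[OF f] circuitsD(4)[OF g] by (simp add: fn_pair[OF f])
next
  fix n x assume x: "x \<in> stage A (Suc n)"
  show "restr (wires (B @ C)) n (fn (pair f g) (Suc n) x) = fn (pair f g) n (restr (wires A) n x)"
    using x restr_append[OF circuitsD(4)[OF f x]] circuitsD(5)[OF f x] circuitsD(5)[OF g x]
    by (simp add: fn_pair[OF f] restr_stage)
next
  fix n x y assume "(x, y) \<in> stage_le A n"
  then show "(fn (pair f g) n x, fn (pair f g) n y) \<in> stage_le (B @ C) n"
    using circuitsD(4,6)[OF f] circuitsD(6)[OF g] stage_leD[of x y A n]
    by (simp add: fn_pair[OF f] stage_le_append)
qed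

lemma tensor_circuit:
  assumes f: "f \<in> circuits A B" and g: "g \<in> circuits C D"
  shows "tensor f g \<in> circuits (A @ C) (B @ D)"
  unfolding tensor_def circuit_source[OF f] circuit_source[OF g]
  by (intro pair_circuit cascade_circuit[OF proj1_circuit f] cascade_circuit[OF proj2_circuit g])

lemma fn_tensor:
  assumes f: "f \<in> circuits A B" and g: "g \<in> circuits C D" and "a \<in> stage A n" "c \<in> stage C n"
  shows "fn (tensor f g) n (a @ c) = fn f n a @ fn g n c"
  using assms(3,4) unfolding tensor_def circuit_source[OF f] circuit_source[OF g]
  by (simp add: fn_pair[OF cascade_circuit[OF proj1_circuit f]] fn_cascade[OF proj1_circuit]
      fn_cascade[OF proj2_circuit] fn_proj1 fn_proj2)

lemma swap_circuit: "swap A B \<in> circuits (A @ B) (B @ A)"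
  unfolding swap_def by (intro pair_circuit proj1_circuit proj2_circuit)

lemma fn_swap: "a \<in> stage A n \<Longrightarrow> b \<in> stage B n \<Longrightarrow> fn (swap A B) n (a @ b) = b @ a"
  by (simp add: swap_def fn_pair[OF proj2_circuit] fn_proj1 fn_proj2)

subsection \<open>Feedback\<close>

lemma fix_pair_circuit:
  assumes "f \<in> circuits (A @ X) (B @ X)"
  shows "pair (ident A) (fixpoint A X (cascade (proj2 B X) f)) \<in> circuits A (A @ X)"
  by (rule pair_circuit[OF ident_circuit fixpoint_circuit(1)[OF cascade_circuit[OF assms proj2_circuit]]])

lemma feedback_circuit:
  assumes "f \<in> circuits (A @ X) (B @ X)"
  shows "feedback A B X f \<in> circuits A B"
  unfolding feedback_def
  by (rule cascade_circuit[OF cascade_circuit[OF fix_pair_circuit[OF assms] assms] proj1_circuit])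

section \<open>Feedback at one stage\<close>

text \<open>Of the conditions imposed by the internal least fixed point at all earlier stages, only
  the one at stage \<open>n\<close> itself is kept; it already determines the value.\<close>

lemma fn_fixpoint_least:
  assumes f: "f \<in> circuits (A @ X) X" and a: "a \<in> stage A n"
  shows "is_least {x \<in> stage X n. fn f n (a @ x) = x} (stage_le X n) (fn (fixpoint A X f) n a)"
proof -
  let ?g = "\<lambda>n. \<lambda>(a, x)\<in>prefixes (cprod (wires A) (wires X)) n. fn f n (a @ x)"
  have "is_lfp_at (wires X) ?g n a (fn (fixpoint A X f) n a)"
    \<comment> \<open>Taking \<open>m = n\<close> and \<open>k = 0\<close> makes
      \<open>restr_down\<close> the identity.\<close>
    using fixpoint_circuit(2)[OF f a, unfolded is_internal_lfp_def, rule_format, of n 0] by simp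
  moreover have "?g n (a, x) = fn f n (a @ x)" if "x \<in> stage X n" for x
    using a that by (simp add: cprod_def)
  then have "{x \<in> stage X n. ?g n (a, x) = x} = {x \<in> stage X n. fn f n (a @ x) = x}"
    by (intro Collect_cong conj_cong refl) (simp only:)
  ultimately show ?thesis by (simp only: is_lfp_at_def)
qed

text \<open>Eliminates feedback in favour of equations for \<open>f\<close> alone, with the loop
  value \<open>x\<close> made explicit. The last clause puts \<open>x\<close> below all pre-fixed
  points of the loop, which by bounded height follows from leastness among fixed points.\<close>

lemma feedbackE:
  assumes f: "f \<in> circuits (A @ X) (B @ X)" and a: "a \<in> stage A n"
  obtains b x where "b \<in> stage B n" "x \<in> stage X n" "fn f n (a @ x) = b @ x"
    "fn (feedback A B X f) n a = b"
    "\<forall>b'\<in>stage B n. \<forall>p\<in>stage X n. \<forall>p'. fn f n (a @ p) = b' @ p' \<longrightarrow>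
      (p', p) \<in> stage_le X n \<longrightarrow> (x, p) \<in> stage_le X n"
proof -
  let ?h = "cascade (proj2 B X) f"
  let ?x = "fn (fixpoint A X ?h) n a"
  have h: "?h \<in> circuits (A @ X) X" by (rule cascade_circuit[OF f proj2_circuit])
  have least: "is_least {x \<in> stage X n. fn ?h n (a @ x) = x} (stage_le X n) ?x"
    by (rule fn_fixpoint_least[OF h a])
  then have x: "?x \<in> stage X n" and fixed: "fn ?h n (a @ ?x) = ?x" by (auto simp: is_least_def)
  have h_eq: "fn ?h n (a @ p) = p'" if "p \<in> stage X n" "b' \<in> stage B n" "fn f n (a @ p) = b' @ p'" for p p' b'
  proof -
    have "p' \<in> stage X n" using circuit_stage[OF f, of "a @ p" n] a that by simp
    then show ?thesis using a that by (simp add: fn_cascade[OF f] fn_proj2)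
  qed
  obtain b y where b: "fn f n (a @ ?x) = b @ y" "b \<in> stage B n" "y \<in> stage X n"
    using circuit_stage[OF f, of "a @ ?x" n] a x by (auto elim: stage_appendE)
  \<comment> \<open>The loop map \<open>?h\<close> returns the \<open>X\<close> part of the output
    of \<open>f\<close>, so at its fixed point that part is the input again.\<close>
  then have y: "y = ?x" using h_eq[OF x] fixed by simp
  show ?thesis
  proof
    let ?q = "pair (ident A) (fixpoint A X ?h)"
    have q: "?q \<in> circuits A (A @ X)" by (rule fix_pair_circuit[OF f])
    have "fn ?q n a = a @ ?x"
      by (simp only: fn_pair[OF ident_circuit a] fn_ident[OF a])
    then show "fn (feedback A B X f) n a = b"
      unfolding feedback_def
      by (simp only: fn_cascade[OF cascade_circuit[OF q f] a] fn_cascade[OF q a] b(1) fn_proj1[OF b(2,3)])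
    have "(?x, p) \<in> stage_le X n"
      if p: "p \<in> stage X n" "b' \<in> stage B n" "fn f n (a @ p) = b' @ p'" "(p', p) \<in> stage_le X n" for b' p p'
    proof -
      \<comment> \<open>A smallest element of the stage, from which the iteration behind
        \<open>is_least_fixed_le_prefixed\<close> starts.\<close>
      obtain z where z: "is_least (stage X n) (stage_le X n) z"
        using internal_bhd_least[OF internal_bhd_wires] by blast
      show ?thesis
      proof (rule is_least_fixed_le_prefixed[OF _ internal_bhd_bounded[OF internal_bhd_wires] z _ _ least p(1)])
        show "partial_order_on (stage X n) (stage_le X n)"
          using internal_bhd_wires unfolding internal_bhd_def by blast
        show "fn ?h n (a @ y) \<in> stage X n" if "y \<in> stage X n" for y
          using circuit_stage[OF h] a that by simp
        show "(fn ?h n (a @ y), fn ?h n (a @ y')) \<in> stage_le X n" if "(y, y') \<in> stage_le X n" for y y'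
          using circuit_mono[OF h] that by (simp add: stage_le_append[OF a a] stage_le_refl[OF a])
        show "(fn ?h n (a @ p), p) \<in> stage_le X n" using h_eq[OF p(1-3)] p(4) by simp
      qed
    qed
    then show "\<forall>b'\<in>stage B n. \<forall>p\<in>stage X n. \<forall>p'. fn f n (a @ p) = b' @ p' \<longrightarrow>
      (p', p) \<in> stage_le X n \<longrightarrow> (?x, p) \<in> stage_le X n"
      by (intro ballI allI impI)
  qed (rule b(2) x b(1)[unfolded y])+
qed

text \<open>The counterpart of \<open>feedbackE\<close> for computing a feedback: a candidate loop
  value need only be compared with genuine fixed points, because antisymmetry then identifies it
  with the value that \<open>feedbackE\<close> supplies.\<close>

lemma feedback_eqI:
  assumes f: "f \<in> circuits (A @ X) (B @ X)" and a: "a \<in> stage A n" and b: "b \<in> stage B n"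
    and x: "x \<in> stage X n" and fx: "fn f n (a @ x) = b @ x"
    and least: "\<And>b' x'. x' \<in> stage X n \<Longrightarrow> b' \<in> stage B n \<Longrightarrow> fn f n (a @ x') = b' @ x' \<Longrightarrow>
      (x, x') \<in> stage_le X n"
  shows "fn (feedback A B X f) n a = b"
proof -
  obtain b' x' where b': "b' \<in> stage B n" and x': "x' \<in> stage X n" and fx': "fn f n (a @ x') = b' @ x'"
    and fb: "fn (feedback A B X f) n a = b'"
    and least': "\<forall>b\<in>stage B n. \<forall>p\<in>stage X n. \<forall>p'. fn f n (a @ p) = b @ p' \<longrightarrow>
      (p', p) \<in> stage_le X n \<longrightarrow> (x', p) \<in> stage_le X n"
    by (rule feedbackE[OF f a])
  have "(x', x) \<in> stage_le X n"
    using least'[rule_format, OF b x fx stage_le_refl[OF x]] .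
  then have "x = x'" by (rule stage_le_antisym[OF least[OF x' b' fx']])
  then have "b @ x = b' @ x" using fx fx' by metis
  then show ?thesis using fb by simp
qed

section \<open>The laws of traced categories\<close>

subsection \<open>The symmetric monoidal structure\<close>

lemma tensor_ident: "tensor (ident A) (ident B) = ident (A @ B)"
proof (rule circuit_eqI[OF tensor_circuit[OF ident_circuit ident_circuit] ident_circuit])
  fix n x assume "x \<in> stage (A @ B) n"
  then show "fn (tensor (ident A) (ident B)) n x = fn (ident (A @ B)) n x"
    by (elim stage_appendE) (simp add: fn_tensor[OF ident_circuit ident_circuit] fn_ident)
qed

lemma tensor_cascade:
  assumes f: "f \<in> circuits A B" and f': "f' \<in> circuits B C"
    and g: "g \<in> circuits A' B'" and g': "g' \<in> circuits B' C'"
  shows "tensor (cascade f' f) (cascade g' g) = cascade (tensor f' g') (tensor f g)"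
proof (rule circuit_eqI[OF tensor_circuit[OF cascade_circuit[OF f f'] cascade_circuit[OF g g']]
      cascade_circuit[OF tensor_circuit[OF f g] tensor_circuit[OF f' g']]])
  fix n x assume "x \<in> stage (A @ A') n"
  then show "fn (tensor (cascade f' f) (cascade g' g)) n x = fn (cascade (tensor f' g') (tensor f g)) n x"
    by (elim stage_appendE)
      (simp add: fn_tensor[OF cascade_circuit[OF f f'] cascade_circuit[OF g g']] fn_tensor[OF f g]
        fn_tensor[OF f' g'] fn_cascade[OF f] fn_cascade[OF g] fn_cascade[OF tensor_circuit[OF f g]]
        circuit_stage[OF f] circuit_stage[OF g])
qed

lemma tensor_tensor:
  assumes f: "f \<in> circuits A A'" and g: "g \<in> circuits B B'" and h: "h \<in> circuits C C'"
  shows "tensor (tensor f g) h = tensor f (tensor g h)"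
proof (rule circuit_eqI[OF tensor_circuit[OF tensor_circuit[OF f g] h, unfolded append_assoc]
      tensor_circuit[OF f tensor_circuit[OF g h]]])
  fix n x assume "x \<in> stage (A @ B @ C) n"
  then obtain a b c where x: "x = a @ b @ c" "a \<in> stage A n" "b \<in> stage B n" "c \<in> stage C n"
    by (elim stage_appendE) simp
  then show "fn (tensor (tensor f g) h) n x = fn (tensor f (tensor g h)) n x"
    \<comment> \<open>The rewriter nests concatenations to the right, so the grouping
      \<open>(a @ b) @ c\<close> has to be instantiated explicitly.\<close>
    using fn_tensor[OF tensor_circuit[OF f g] h, of "a @ b" n c]
    by (simp add: fn_tensor[OF f g] fn_tensor[OF f tensor_circuit[OF g h]] fn_tensor[OF g h])
qed

lemma tensor_ident_Nil_left:
  assumes f: "f \<in> circuits A B"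
  shows "tensor (ident []) f = f"
proof (rule circuit_eqI[OF tensor_circuit[OF ident_circuit[of "[]"] f, unfolded append_Nil] f])
  fix n x assume "x \<in> stage A n"
  then show "fn (tensor (ident []) f) n x = fn f n x"
    using fn_tensor[OF ident_circuit f, of "[]" "[]" n x] by (simp add: fn_ident)
qed

lemma tensor_ident_Nil_right:
  assumes f: "f \<in> circuits A B"
  shows "tensor f (ident []) = f"
proof (rule circuit_eqI[OF tensor_circuit[OF f ident_circuit[of "[]"], unfolded append_Nil2] f])
  fix n x assume "x \<in> stage A n"
  then show "fn (tensor f (ident [])) n x = fn f n x"
    using fn_tensor[OF f ident_circuit, of x n "[]" "[]"] by (simp add: fn_ident)
qed

lemma swap_natural:
  assumes f: "f \<in> circuits A A'" and g: "g \<in> circuits B B'"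
  shows "cascade (swap A' B') (tensor f g) = cascade (tensor g f) (swap A B)"
proof (rule circuit_eqI[OF cascade_circuit[OF tensor_circuit[OF f g] swap_circuit]
      cascade_circuit[OF swap_circuit tensor_circuit[OF g f]]])
  fix n x assume "x \<in> stage (A @ B) n"
  then show "fn (cascade (swap A' B') (tensor f g)) n x = fn (cascade (tensor g f) (swap A B)) n x"
    by (elim stage_appendE)
      (simp add: fn_cascade[OF tensor_circuit[OF f g]] fn_cascade[OF swap_circuit] fn_swap
        fn_tensor[OF f g] fn_tensor[OF g f] circuit_stage[OF f] circuit_stage[OF g])
qed

lemma swap_swap: "cascade (swap B A) (swap A B) = ident (A @ B)"
proof (rule circuit_eqI[OF cascade_circuit[OF swap_circuit swap_circuit] ident_circuit])
  fix n x assume "x \<in> stage (A @ B) n"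
  then show "fn (cascade (swap B A) (swap A B)) n x = fn (ident (A @ B)) n x"
    by (elim stage_appendE) (simp add: fn_cascade[OF swap_circuit] fn_swap fn_ident)
qed

lemma swap_append:
  "swap A (B @ C) = cascade (tensor (ident B) (swap A C)) (tensor (swap A B) (ident C))"
proof -
  \<comment> \<open>The interfaces of the two factors are rebracketed so that target and source
    match.\<close>
  have l: "tensor (swap A B) (ident C) \<in> circuits (A @ B @ C) (B @ A @ C)"
    using tensor_circuit[OF swap_circuit ident_circuit] by simp
  have r: "tensor (ident B) (swap A C) \<in> circuits (B @ A @ C) ((B @ C) @ A)"
    using tensor_circuit[OF ident_circuit swap_circuit] by simp
  show ?thesis
  proof (rule circuit_eqI[OF swap_circuit cascade_circuit[OF l r]])
    fix n x assume "x \<in> stage (A @ B @ C) n"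
    then obtain a b c where x: "x = a @ b @ c" "a \<in> stage A n" "b \<in> stage B n" "c \<in> stage C n"
      by (elim stage_appendE) simp
    then show "fn (swap A (B @ C)) n x =
        fn (cascade (tensor (ident B) (swap A C)) (tensor (swap A B) (ident C))) n x"
      using fn_tensor[OF swap_circuit ident_circuit, of "a @ b" A B n c C]
      by (simp add: fn_cascade[OF l] fn_swap fn_ident fn_tensor[OF ident_circuit swap_circuit])
  qed
qed

lemma symmetric_monoidal_category_circuits:
  "symmetric_monoidal_category (circuits :: 'a interface \<Rightarrow> 'a interface \<Rightarrow> 'a circuit set)
     ident cascade (@) [] tensor swap"
proof
  fix A B C D :: "'a interface" and f g h :: "'a circuit"
  show "cascade (ident B) f = f" if f: "f \<in> circuits A B"
    by (rule circuit_eqI[OF cascade_circuit[OF f ident_circuit] f])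
      (simp add: fn_cascade[OF f] fn_ident circuit_stage[OF f])
  show "cascade f (ident A) = f" if f: "f \<in> circuits A B"
    by (rule circuit_eqI[OF cascade_circuit[OF ident_circuit f] f])
      (simp add: fn_cascade[OF ident_circuit] fn_ident)
  show "cascade (cascade h g) f = cascade h (cascade g f)"
    if f: "f \<in> circuits A B" and g: "g \<in> circuits B C" and h: "h \<in> circuits C D"
    by (rule circuit_eqI[OF cascade_circuit[OF f cascade_circuit[OF g h]]
          cascade_circuit[OF cascade_circuit[OF f g] h]])
      (simp add: fn_cascade[OF f] fn_cascade[OF g] fn_cascade[OF cascade_circuit[OF f g]] circuit_stage[OF f])
qed (simp_all add: ident_circuit cascade_circuit tensor_circuit tensor_ident tensor_cascade tensor_tensor
    tensor_ident_Nil_left tensor_ident_Nil_right swap_circuit[simplified] swap_natural swap_swap swap_append)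

subsection \<open>The trace\<close>

text \<open>At \<open>a\<close>, the loop of the composite is literally the loop of \<open>f\<close>
  at the parameter \<open>fn g n a\<close>.\<close>

lemma feedback_natural_source:
  assumes f: "f \<in> circuits (A @ X) (B @ X)" and g: "g \<in> circuits A' A"
  shows "feedback A' B X (cascade f (tensor g (ident X))) = cascade (feedback A B X f) g"
proof -
  let ?h = "cascade f (tensor g (ident X))"
  note gX = tensor_circuit[OF g ident_circuit[of X]]
  note h = cascade_circuit[OF gX f]
  show ?thesis
  proof (rule circuit_eqI[OF feedback_circuit[OF h] cascade_circuit[OF g feedback_circuit[OF f]]])
    fix n a assume a: "a \<in> stage A' n"
    have ev: "fn ?h n (a @ x) = fn f n (fn g n a @ x)" if "x \<in> stage X n" for x
      using a that by (simp add: fn_cascade[OF gX] fn_tensor[OF g ident_circuit] fn_ident)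
    obtain b x where b: "b \<in> stage B n" and x: "x \<in> stage X n" and fx: "fn f n (fn g n a @ x) = b @ x"
      and fb: "fn (feedback A B X f) n (fn g n a) = b"
      and least: "\<forall>b'\<in>stage B n. \<forall>p\<in>stage X n. \<forall>p'. fn f n (fn g n a @ p) = b' @ p' \<longrightarrow>
        (p', p) \<in> stage_le X n \<longrightarrow> (x, p) \<in> stage_le X n"
      by (rule feedbackE[OF f circuit_stage[OF g a]])
    have "fn (feedback A' B X ?h) n a = b"
    proof (rule feedback_eqI[OF h a b x])
      show "fn ?h n (a @ x) = b @ x" using fx by (simp add: ev[OF x])
    next
      fix b' x' assume "x' \<in> stage X n" "b' \<in> stage B n" "fn ?h n (a @ x') = b' @ x'"
      then show "(x, x') \<in> stage_le X n" using least ev stage_le_refl by metis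
    qed
    then show "fn (feedback A' B X ?h) n a = fn (cascade (feedback A B X f) g) n a"
      using fb by (simp add: fn_cascade[OF g a])
  qed
qed

text \<open>Postcomposing with \<open>g\<close> changes only the \<open>B\<close> part of the
  output, so both loops have the same fixed points.\<close>

lemma feedback_natural_target:
  assumes f: "f \<in> circuits (A @ X) (B @ X)" and g: "g \<in> circuits B B'"
  shows "feedback A B' X (cascade (tensor g (ident X)) f) = cascade g (feedback A B X f)"
proof -
  let ?h = "cascade (tensor g (ident X)) f"
  note gX = tensor_circuit[OF g ident_circuit[of X]]
  note h = cascade_circuit[OF f gX]
  show ?thesis
  proof (rule circuit_eqI[OF feedback_circuit[OF h] cascade_circuit[OF feedback_circuit[OF f] g]])
    fix n a assume a: "a \<in> stage A n"
    have ev: "fn ?h n (a @ x) = fn g n b @ y"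
      if "x \<in> stage X n" "b \<in> stage B n" "y \<in> stage X n" "fn f n (a @ x) = b @ y" for x b y
      using a that by (simp add: fn_cascade[OF f] fn_tensor[OF g ident_circuit] fn_ident)
    obtain b x where b: "b \<in> stage B n" and x: "x \<in> stage X n" and fx: "fn f n (a @ x) = b @ x"
      and fb: "fn (feedback A B X f) n a = b"
      and least: "\<forall>b'\<in>stage B n. \<forall>p\<in>stage X n. \<forall>p'. fn f n (a @ p) = b' @ p' \<longrightarrow>
        (p', p) \<in> stage_le X n \<longrightarrow> (x, p) \<in> stage_le X n"
      by (rule feedbackE[OF f a])
    have "fn (feedback A B' X ?h) n a = fn g n b"
    proof (rule feedback_eqI[OF h a circuit_stage[OF g b] x ev[OF x b x fx]])
      fix b' x' assume x': "x' \<in> stage X n" and b': "b' \<in> stage B' n" and eq: "fn ?h n (a @ x') = b' @ x'"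
      have "a @ x' \<in> stage (A @ X) n" using a x' by simp
      then obtain b'' y where y: "fn f n (a @ x') = b'' @ y" "b'' \<in> stage B n" "y \<in> stage X n"
        by (rule circuit_appendE[OF f])
      \<comment> \<open>Cancelling the \<open>B'\<close> parts shows that a fixed point of the
        composite loop is one of the loop of \<open>f\<close>.\<close>
      have "y = x'"
        using ev[OF x' y(2,3,1)] eq stage_append_eq[OF circuit_stage[OF g y(2)] b'] by metis
      then show "(x, x') \<in> stage_le X n" using least y x' stage_le_refl by metis
    qed
    then show "fn (feedback A B' X ?h) n a = fn (cascade g (feedback A B X f)) n a"
      using fb by (simp add: fn_cascade[OF feedback_circuit[OF f] a])
  qed
qed

text \<open>Write \<open>k\<close> for the \<open>Y\<close> part of \<open>f\<close> at a fixed
  parameter. Then \<open>h\<close> and \<open>k\<close> exchange the fixed points of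
  \<open>h\<close> after \<open>k\<close> with those of \<open>k\<close> after \<open>h\<close>, and
  the monotone \<open>h\<close> carries the least one to the least one.\<close>

lemma feedback_dinatural:
  assumes f: "f \<in> circuits (A @ X) (B @ Y)" and h: "h \<in> circuits Y X"
  shows "feedback A B X (cascade (tensor (ident B) h) f) = feedback A B Y (cascade f (tensor (ident A) h))"
proof -
  let ?p = "cascade (tensor (ident B) h) f" and ?q = "cascade f (tensor (ident A) h)"
  note Bh = tensor_circuit[OF ident_circuit[of B] h] and Ah = tensor_circuit[OF ident_circuit[of A] h]
  note p = cascade_circuit[OF f Bh] and q = cascade_circuit[OF Ah f]
  show ?thesis
  proof (rule circuit_eqI[OF feedback_circuit[OF p] feedback_circuit[OF q]])
    fix n a assume a: "a \<in> stage A n"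
    have ev_p: "fn ?p n (a @ x) = b @ fn h n y"
      if "x \<in> stage X n" "b \<in> stage B n" "y \<in> stage Y n" "fn f n (a @ x) = b @ y" for x b y
      using a that by (simp add: fn_cascade[OF f] fn_tensor[OF ident_circuit h] fn_ident)
    have ev_q: "fn ?q n (a @ y) = fn f n (a @ fn h n y)" if "y \<in> stage Y n" for y
      using a that by (simp add: fn_cascade[OF Ah] fn_tensor[OF ident_circuit h] fn_ident)
    obtain b y where b: "b \<in> stage B n" and y: "y \<in> stage Y n" and qy: "fn ?q n (a @ y) = b @ y"
      and fb: "fn (feedback A B Y ?q) n a = b"
      and least: "\<forall>b'\<in>stage B n. \<forall>p\<in>stage Y n. \<forall>p'. fn ?q n (a @ p) = b' @ p' \<longrightarrow>
        (p', p) \<in> stage_le Y n \<longrightarrow> (y, p) \<in> stage_le Y n"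
      by (rule feedbackE[OF q a])
    have "fn (feedback A B X ?p) n a = b"
    proof (rule feedback_eqI[OF p a b circuit_stage[OF h y]])
      show "fn ?p n (a @ fn h n y) = b @ fn h n y"
        using ev_p[OF circuit_stage[OF h y] b y] qy ev_q[OF y] by simp
    next
      fix b' x' assume x': "x' \<in> stage X n" and b': "b' \<in> stage B n" and eq: "fn ?p n (a @ x') = b' @ x'"
      have "a @ x' \<in> stage (A @ X) n" using a x' by simp
      then obtain b'' y' where y': "fn f n (a @ x') = b'' @ y'" "b'' \<in> stage B n" "y' \<in> stage Y n"
        by (rule circuit_appendE[OF f])
      \<comment> \<open>Hence \<open>y'\<close>, the \<open>Y\<close> output at the fixed point
        \<open>x'\<close>, is itself a fixed point of the loop along \<open>Y\<close>, and it lies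
        above \<open>y\<close>.\<close>
      have hy': "fn h n y' = x'"
        using ev_p[OF x' y'(2,3,1)] eq stage_append_eq[OF y'(2) b'] by metis
      then have "(y, y') \<in> stage_le Y n"
        using least[rule_format, OF y'(2,3) _ stage_le_refl[OF y'(3)]] y'(1) ev_q[OF y'(3)] by simp
      then show "(fn h n y, x') \<in> stage_le X n"
        using circuit_mono[OF h] hy' by metis
    qed
    then show "fn (feedback A B X ?p) n a = fn (feedback A B Y ?q) n a" using fb by simp
  qed
qed

section \<open>Vanishing\<close>

text \<open>A stage of the empty interface has the empty list as its only point, so the loop value
  is forced.\<close>

lemma feedback_Nil:
  assumes f: "f \<in> circuits A B"
  shows "feedback A B [] f = f"
proof -
  have f': "f \<in> circuits (A @ []) (B @ [])" using f by simp
  show ?thesis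
  proof (rule circuit_eqI[OF feedback_circuit[OF f'] f])
    fix n a assume a: "a \<in> stage A n"
    show "fn (feedback A B [] f) n a = fn f n a"
      by (rule feedback_eqI[OF f' a circuit_stage[OF f a], of "[]"]) (simp_all add: stage_le_refl)
  qed
qed

text \<open>
  Bekic's lemma. That the simultaneous least fixed point is bounded below by the iterated one
  uses leastness of both partial fixed points among the points that are only pre-fixed.
\<close>

lemma feedback_append:
  assumes f: "f \<in> circuits (A @ X @ Y) (B @ X @ Y)"
  shows "feedback A B (X @ Y) f = feedback A B X (feedback (A @ X) (B @ X) Y f)"
proof -
  let ?g = "feedback (A @ X) (B @ X) Y f"
  \<comment> \<open>The same circuit, bracketed for the inner loop: \<open>Y\<close> is fed back
    while \<open>X\<close> is still a parameter.\<close>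
  have f': "f \<in> circuits ((A @ X) @ Y) ((B @ X) @ Y)" using f by simp
  note g = feedback_circuit[OF f']
  show ?thesis
  proof (rule circuit_eqI[OF feedback_circuit[OF f] feedback_circuit[OF g]])
    fix n a assume a: "a \<in> stage A n"
    obtain b x where b: "b \<in> stage B n" and x: "x \<in> stage X n" and gx: "fn ?g n (a @ x) = b @ x"
      and fb: "fn (feedback A B X ?g) n a = b"
      and least_x: "\<forall>b'\<in>stage B n. \<forall>p\<in>stage X n. \<forall>p'. fn ?g n (a @ p) = b' @ p' \<longrightarrow>
        (p', p) \<in> stage_le X n \<longrightarrow> (x, p) \<in> stage_le X n"
      by (rule feedbackE[OF g a])
    have ax: "a @ x \<in> stage (A @ X) n" using a x by simp
    obtain c y where "c \<in> stage (B @ X) n" and y: "y \<in> stage Y n" and "fn f n ((a @ x) @ y) = c @ y"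
      and "fn ?g n (a @ x) = c"
      and least_y: "\<forall>b'\<in>stage (B @ X) n. \<forall>p\<in>stage Y n. \<forall>p'. fn f n ((a @ x) @ p) = b' @ p' \<longrightarrow>
        (p', p) \<in> stage_le Y n \<longrightarrow> (y, p) \<in> stage_le Y n"
      by (rule feedbackE[OF f' ax])
    \<comment> \<open>Here \<open>x\<close> solves the outer loop and \<open>y\<close> the inner
      loop at \<open>x\<close>; together they solve the simultaneous loop.\<close>
    then have fxy: "fn f n (a @ x @ y) = b @ x @ y" using gx by simp
    have xy: "x @ y \<in> stage (X @ Y) n" using x y by simp
    have "fn (feedback A B (X @ Y) f) n a = b"
    proof (rule feedback_eqI[OF f a b xy fxy])
      fix b' z assume z: "z \<in> stage (X @ Y) n" and b': "b' \<in> stage B n" and fz: "fn f n (a @ z) = b' @ z"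
      obtain x' y' where z_eq: "z = x' @ y'" and x': "x' \<in> stage X n" and y': "y' \<in> stage Y n"
        using z by (rule stage_appendE)
      have ax': "a @ x' \<in> stage (A @ X) n" and bx': "b' @ x' \<in> stage (B @ X) n"
        using a b' x' by simp_all
      obtain c' y'' where c': "c' \<in> stage (B @ X) n" and y'': "y'' \<in> stage Y n"
        and fy'': "fn f n ((a @ x') @ y'') = c' @ y''" and gx': "fn ?g n (a @ x') = c'"
        and least': "\<forall>b'\<in>stage (B @ X) n. \<forall>p\<in>stage Y n. \<forall>p'. fn f n ((a @ x') @ p) = b' @ p' \<longrightarrow>
          (p', p) \<in> stage_le Y n \<longrightarrow> (y'', p) \<in> stage_le Y n"
        by (rule feedbackE[OF f' ax'])
      have fz': "fn f n ((a @ x') @ y') = (b' @ x') @ y'" using fz z_eq by simp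
      \<comment> \<open>For a simultaneous fixed point \<open>x' @ y'\<close>, the part
        \<open>y'\<close> is one inner fixed point at \<open>x'\<close>, and \<open>y''\<close> is
        the least.\<close>
      have "(y'', y') \<in> stage_le Y n"
        by (rule least'[rule_format, OF bx' y' fz' stage_le_refl[OF y']])
      then have "((a @ x') @ y'', (a @ x') @ y') \<in> stage_le ((A @ X) @ Y) n"
        by (simp only: stage_le_append[OF ax' ax'] stage_le_refl[OF ax'])
      then have "(c' @ y'', (b' @ x') @ y') \<in> stage_le ((B @ X) @ Y) n"
        using circuit_mono[OF f'] fy'' fz' by metis
      then have c'_le: "(c', b' @ x') \<in> stage_le (B @ X) n"
        using stage_le_append[OF c' bx'] by blast
      obtain b2 x2 where c'_eq: "c' = b2 @ x2" and b2: "b2 \<in> stage B n"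
        using c' by (rule stage_appendE)
      then have x2: "(x2, x') \<in> stage_le X n"
        using c'_le stage_le_append[OF b2 b'] by blast
      \<comment> \<open>By monotonicity the outer loop sends \<open>x'\<close> to \<open>x2\<close>,
        which lies below \<open>x'\<close>: thus \<open>x'\<close> is pre-fixed, though perhaps not
        fixed.\<close>
      have xx': "(x, x') \<in> stage_le X n"
        by (rule least_x[rule_format, OF b2 x' _ x2]) (simp only: gx' c'_eq)
      \<comment> \<open>Lowering \<open>x'\<close> to \<open>x\<close> can only lower the output, so
        \<open>y'\<close> becomes pre-fixed for the inner loop at \<open>x\<close>, where
        \<open>y\<close> is least.\<close>
      have "((a @ x) @ y', (a @ x') @ y') \<in> stage_le ((A @ X) @ Y) n"
        using xx' by (simp only: stage_le_append[OF ax ax'] stage_le_append[OF a a]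
            stage_le_refl[OF a] stage_le_refl[OF y'])
      then have le: "(fn f n ((a @ x) @ y'), (b' @ x') @ y') \<in> stage_le ((B @ X) @ Y) n"
        using circuit_mono[OF f'] fz' by metis
      have "(a @ x) @ y' \<in> stage ((A @ X) @ Y) n" using ax y' by (simp only: stage_append)
      then obtain c3 y3 where c3: "fn f n ((a @ x) @ y') = c3 @ y3" "c3 \<in> stage (B @ X) n" "y3 \<in> stage Y n"
        by (rule circuit_appendE[OF f'])
      then have "(y3, y') \<in> stage_le Y n"
        using le stage_le_append[OF c3(2) bx'] by metis
      then have "(y, y') \<in> stage_le Y n"
        by (rule least_y[rule_format, OF c3(2) y' c3(1)])
      then show "(x @ y, z) \<in> stage_le (X @ Y) n"
        using xx' z_eq stage_le_append[OF x x'] by simp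
    qed
    then show "fn (feedback A B (X @ Y) f) n a = fn (feedback A B X ?g) n a" using fb by simp
  qed
qed

section \<open>Superposing and yanking\<close>

text \<open>The two symmetries merely route the wires of \<open>g\<close> around the loop, so the
  \<open>X\<close> part of the output is that of \<open>f\<close> and does not depend on
  \<open>c\<close>.\<close>

lemma feedback_superposing:
  assumes f: "f \<in> circuits (A @ X) (B @ X)" and g: "g \<in> circuits C D"
  shows "feedback (A @ C) (B @ D) X
      (cascade (cascade (tensor (ident B) (swap X D)) (tensor f g)) (tensor (ident A) (swap C X)))
    = tensor (feedback A B X f) g"
proof -
  let ?l = "tensor (ident B) (swap X D)" and ?r = "tensor (ident A) (swap C X)"
  let ?h = "cascade (cascade ?l (tensor f g)) ?r"
  have r: "?r \<in> circuits ((A @ C) @ X) (A @ X @ C)"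
    using tensor_circuit[OF ident_circuit swap_circuit] by simp
  have l: "?l \<in> circuits (B @ X @ D) ((B @ D) @ X)"
    using tensor_circuit[OF ident_circuit swap_circuit] by simp
  have fg: "tensor f g \<in> circuits (A @ X @ C) (B @ X @ D)"
    using tensor_circuit[OF f g] by simp
  note h = cascade_circuit[OF r cascade_circuit[OF fg l]]
  show ?thesis
  proof (rule circuit_eqI[OF feedback_circuit[OF h] tensor_circuit[OF feedback_circuit[OF f] g]])
    fix n z assume "z \<in> stage (A @ C) n"
    then obtain a c where z: "z = a @ c" and a: "a \<in> stage A n" and c: "c \<in> stage C n"
      by (rule stage_appendE)
    have ac: "a @ c \<in> stage (A @ C) n" using a c by simp
    \<comment> \<open>The intermediate tuples are \<open>a @ x @ c\<close> after the first symmetry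
      and \<open>b @ y @ fn g n c\<close> before the second.\<close>
    have ev: "fn ?h n ((a @ c) @ x) = (b @ fn g n c) @ y"
      if "x \<in> stage X n" "b \<in> stage B n" "y \<in> stage X n" "fn f n (a @ x) = b @ y" for x b y
      using a c that fn_tensor[OF f g, of "a @ x" n c]
      by (simp add: fn_cascade[OF r] fn_cascade[OF fg] fn_tensor[OF ident_circuit swap_circuit]
          fn_ident fn_swap circuit_stage[OF g])
    obtain b x where b: "b \<in> stage B n" and x: "x \<in> stage X n" and fx: "fn f n (a @ x) = b @ x"
      and fb: "fn (feedback A B X f) n a = b"
      and least: "\<forall>b'\<in>stage B n. \<forall>p\<in>stage X n. \<forall>p'. fn f n (a @ p) = b' @ p' \<longrightarrow>
        (p', p) \<in> stage_le X n \<longrightarrow> (x, p) \<in> stage_le X n"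
      by (rule feedbackE[OF f a])
    have bg: "b' @ fn g n c \<in> stage (B @ D) n" if "b' \<in> stage B n" for b'
      using that circuit_stage[OF g c] by simp
    have "fn (feedback (A @ C) (B @ D) X ?h) n (a @ c) = b @ fn g n c"
    proof (rule feedback_eqI[OF h ac bg[OF b] x ev[OF x b x fx]])
      fix b' x' assume x': "x' \<in> stage X n" and b': "b' \<in> stage (B @ D) n"
        and eq: "fn ?h n ((a @ c) @ x') = b' @ x'"
      have "a @ x' \<in> stage (A @ X) n" using a x' by simp
      then obtain b'' y where y: "fn f n (a @ x') = b'' @ y" "b'' \<in> stage B n" "y \<in> stage X n"
        by (rule circuit_appendE[OF f])
      have "y = x'"
        using ev[OF x' y(2,3,1)] eq stage_append_eq[OF bg[OF y(2)] b'] by metis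
      then show "(x, x') \<in> stage_le X n" using least y x' stage_le_refl by metis
    qed
    then show "fn (feedback (A @ C) (B @ D) X ?h) n z = fn (tensor (feedback A B X f) g) n z"
      using fb a c by (simp add: z fn_tensor[OF feedback_circuit[OF f] g])
  qed
qed

text \<open>The loop map is constant with value \<open>a\<close>, so \<open>a\<close> is its only
  fixed point, and the output at it is again \<open>a\<close>.\<close>

lemma feedback_swap: "feedback X X X (swap X X) = ident X"
proof (rule circuit_eqI[OF feedback_circuit[OF swap_circuit] ident_circuit])
  fix n a assume a: "a \<in> stage X n"
  have "fn (feedback X X X (swap X X)) n a = a"
  proof (rule feedback_eqI[OF swap_circuit a a a])
    show "fn (swap X X) n (a @ a) = a @ a" using a by (simp add: fn_swap)
  next
    fix b' x' assume "x' \<in> stage X n" "b' \<in> stage X n" "fn (swap X X) n (a @ x') = b' @ x'"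
    then have "x' = a" using a stage_append_eq[of x' X n b' a x'] by (simp add: fn_swap)
    then show "(a, x') \<in> stage_le X n" using stage_le_refl[OF a] by simp
  qed
  then show "fn (feedback X X X (swap X X)) n a = fn (ident X) n a" by (simp add: fn_ident[OF a])
qed

theorem mainTheorem1:
  shows "traced_monoidal_category (circuits :: 'a interface \<Rightarrow> 'a interface \<Rightarrow> 'a circuit set)
           ident cascade (@) [] tensor swap feedback"
proof (rule traced_monoidal_category.intro[OF symmetric_monoidal_category_circuits], unfold_locales)
qed (simp_all add: feedback_circuit feedback_natural_source feedback_natural_target feedback_dinatural
    feedback_Nil feedback_append feedback_superposing feedback_swap)

end
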